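(* Let $\alpha \in \{2,3,4,5,6\}$ and let $f:[-1/2,1/2]\rightarrow\mathbb{R}$ be smooth and even. Define $$ \max(\widehat{f}) = \max\left\{ \sup_{k \in \mathbb{Z}_{\geq 0}} \left(2k+\tfrac12\right)\widehat{f}\left(2k+\tfrac12\right),\; -\inf_{k\in\mathbb{Z}_{\geq 0}} \left(2k+\tfrac32\right)\widehat{f}\left(2k+\tfrac32\right)\right\}.$$ Then $$ \max(\widehat{f}) \geq \frac{\alpha+1}{\alpha\pi}\int_{-1/2}^{1/2} \left(1-|2x|^{\alpha}\right) f(x)\,dx.$$
   Context: The Fourier transform is $\widehat{f}(\xi) = \int_{-1/2}^{1/2} f(x) e^{-2\pi i \xi x}\,dx$ (real-valued, since $f$ is real and even). Smooth means $C^\infty$ up to the endpoints of the closed interval $[-1/2,1/2]$; $f$ need not vanish at the endpoints. *)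

theory Defs
  imports "HOL-Analysis.Analysis"
begin

text \<open>
  \<open>D n\<close> is the \<open>n\<close>-th derivative of \<open>f\<close>. Derivatives are taken within the
  closed interval, so they are one-sided at the endpoints; each \<open>D n\<close> is differentiable, hence
  continuous, up to the endpoints. The values of \<open>f\<close> outside \<open>{a..b}\<close> are irrelevant.
\<close>
definition smooth_on_interval :: "real \<Rightarrow> real \<Rightarrow> (real \<Rightarrow> real) \<Rightarrow> bool" where
  "smooth_on_interval a b f \<longleftrightarrow>
     (\<exists>D :: nat \<Rightarrow> real \<Rightarrow> real.
        (\<forall>x\<in>{a..b}. D 0 x = f x) \<and>
        (\<forall>n. \<forall>x\<in>{a..b}. (D n has_real_derivative D (Suc n) x) (at x within {a..b})))"

definition fourier :: "(real \<Rightarrow> real) \<Rightarrow> real \<Rightarrow> complex" where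
  "fourier f \<xi> =
     integral {-1/2..1/2}
       (\<lambda>x. complex_of_real (f x) * exp (- 2 * complex_of_real pi * \<i> * complex_of_real (\<xi> * x)))"

text \<open>
  For even real \<open>f\<close> the transform is real-valued, so taking \<open>Re\<close> loses nothing. For smooth \<open>f\<close>
  integration by parts bounds \<open>\<xi> * fourier f \<xi>\<close>, so \<open>SUP\<close> and \<open>INF\<close> over \<open>real\<close> are the true
  supremum and infimum.
\<close>
definition max_fourier :: "(real \<Rightarrow> real) \<Rightarrow> real" where
  "max_fourier f =
     max (SUP k::nat. (2 * real k + 1/2) * Re (fourier f (2 * real k + 1/2)))
         (- (INF k::nat. (2 * real k + 3/2) * Re (fourier f (2 * real k + 3/2))))"

end

theory Submission
  imports Defs
begin

text \<open>
  The two families of frequencies are \<open>j + 1/2\<close> with \<open>j\<close> even and with \<open>j\<close> odd, and the functions \<open>cos ((2j+1) \<pi> x)\<close> form an orthogonal basis of the even functions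
  on \<open>[-1/2, 1/2]\<close>. Write \<open>c\<^sub>j(h)\<close> for the integral of \<open>h\<close> against the \<open>j\<close>-th one, so that
  \<open>c\<^sub>j(f)\<close> is the Fourier transform of \<open>f\<close> at \<open>j + 1/2\<close>. The maximum \<open>M\<close> in the theorem is the least
  number with \<open>(-1)\<^sup>j (j + 1/2) c\<^sub>j(f) \<le> M\<close> for all \<open>j\<close>.

  Constant functions turn all these inequalities into equalities: \<open>(-1)\<^sup>j (j + 1/2) c\<^sub>j(1) = 1/\<pi>\<close>. So
  \<open>g = \<pi> M - f\<close> satisfies \<open>(-1)\<^sup>j c\<^sub>j(g) \<ge> 0\<close> for every \<open>j\<close>. The weight \<open>w(x) = 1 - |2x|^\<alpha>\<close> has
  coefficients with the same sign pattern, \<open>(-1)\<^sup>j c\<^sub>j(w) \<ge> 0\<close> (\<open>half_moment_alternating\<close>); this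
  is where \<open>2 \<le> \<alpha> \<le> 6\<close> enters. Parseval's identity (\<open>parseval_oddcos\<close>) expresses
  the integral of \<open>w g\<close> as the sum of the nonnegative terms \<open>2 c\<^sub>j(w) c\<^sub>j(g)\<close>. Hence
  the integral of \<open>w f\<close> is at most \<open>\<pi> M\<close> times the integral of \<open>w\<close>, which is \<open>\<alpha>/(\<alpha>+1)\<close>.

  Since \<open>c\<^sub>j(w) = O(1/j\<^sup>2)\<close>, the cosine series of \<open>w\<close> converges uniformly, and Parseval's
  identity follows by termwise integration once the sum of the series is known to be \<open>w\<close>. The
  latter is the completeness of the system (\<open>oddcos_complete\<close>), a consequence of the Weierstrass
  approximation theorem.
\<close>

section \<open>Cosines of odd frequency on the centred unit interval\<close>

definition oddcos :: "nat \<Rightarrow> real \<Rightarrow> real" where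
  "oddcos j x = cos (real (2 * j + 1) * pi * x)"

definition oddcos_coeff :: "(real \<Rightarrow> real) \<Rightarrow> nat \<Rightarrow> real" where
  "oddcos_coeff h j = integral {-1/2..1/2} (\<lambda>x. h x * oddcos j x)"

lemma continuous_on_oddcos [continuous_intros]: "continuous_on A (oddcos j)"
  unfolding oddcos_def by (intro continuous_intros)

lemma abs_oddcos_le: "\<bar>oddcos j x\<bar> \<le> 1"
  by (simp add: oddcos_def)

lemma oddcos_minus [simp]: "oddcos j (- x) = oddcos j x"
  by (simp add: oddcos_def)

lemma sin_odd_half_pi: "sin (real (2 * j + 1) * pi / 2) = (-1) ^ j"
  using sin_cos_npi[of j] by (simp add: algebra_simps)

lemma cos_odd_half_pi: "cos (real (2 * j + 1) * pi / 2) = 0"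
  using cos_pi_eq_zero[of j] by (simp add: algebra_simps)

lemma integral_cos_scaled:
  fixes c :: real
  assumes "c \<noteq> 0"
  shows "((\<lambda>x. cos (c * x)) has_integral 2 * sin (c / 2) / c) {-1/2..1/2}"
proof -
  have "((\<lambda>x. cos (c * x)) has_integral (sin (c * (1/2)) / c - sin (c * (-1/2)) / c)) {-1/2..1/2}"
    by (rule fundamental_theorem_of_calculus)
       (use assms in \<open>auto intro!: derivative_eq_intros
          simp flip: has_real_derivative_iff_has_vector_derivative\<close>)
  then show ?thesis by simp
qed

lemma has_integral_cos_int:
  "((\<lambda>x. cos (2 * pi * real_of_int n * x)) has_integral (if n = 0 then 1 else 0)) {-1/2..1/2}"
proof (cases "n = 0")
  case True
  then show ?thesis using has_integral_const_real[of "1::real" "-1/2" "1/2"] by simp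
next
  case False
  have "sin (2 * pi * real_of_int n / 2) = 0"
    by (auto simp: sin_zero_iff_int2)
  with integral_cos_scaled[of "2 * pi * real_of_int n"] False show ?thesis by simp
qed

lemma oddcos_orthogonal:
  "oddcos_coeff (oddcos j) k = (if j = k then 1/2 else 0)"
proof -
  have eq: "oddcos j x * oddcos k x =
      (cos (2 * pi * real_of_int (int j - int k) * x)
        + cos (2 * pi * real_of_int (int (j + k + 1)) * x)) / 2" for x
    unfolding oddcos_def cos_times_cos by (simp add: algebra_simps)
  have "((\<lambda>x. oddcos j x * oddcos k x) has_integral
      ((if int j - int k = 0 then 1 else 0) + (if int (j + k + 1) = 0 then 1 else 0)) / 2) {-1/2..1/2}"
    unfolding eq by (intro has_integral_divide has_integral_add has_integral_cos_int)
  then show ?thesis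
    unfolding oddcos_coeff_def by (auto dest!: integral_unique)
qed

lemma oddcos_coeff_const: "oddcos_coeff (\<lambda>x. c) j = c * (2 * (-1) ^ j / (real (2 * j + 1) * pi))"
proof -
  have "(oddcos j has_integral 2 * (-1) ^ j / (real (2 * j + 1) * pi)) {-1/2..1/2}"
    using integral_cos_scaled[of "real (2 * j + 1) * pi"] sin_odd_half_pi[of j]
    unfolding oddcos_def by simp
  from has_integral_mult_right[OF this, of c] show ?thesis
    unfolding oddcos_coeff_def by (rule integral_unique)
qed

lemma oddcos_coeff_diff:
  assumes "continuous_on {-1/2..1/2} g" "continuous_on {-1/2..1/2} h"
  shows "oddcos_coeff (\<lambda>x. g x - h x) j = oddcos_coeff g j - oddcos_coeff h j"
  unfolding oddcos_coeff_def left_diff_distrib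
  by (intro Henstock_Kurzweil_Integration.integral_diff integrable_continuous_interval
        continuous_intros assms)

text \<open>
  Multiplication by \<open>cos (2 \<pi> x)\<close> averages two neighbouring basis functions, so orthogonality to the
  whole basis passes to all products of a basis function and a polynomial in \<open>cos (2 \<pi> x)\<close>.
\<close>
lemma oddcos_moments_zero:
  assumes cont: "continuous_on {-1/2..1/2} G" and zero: "\<And>j. oddcos_coeff G j = 0"
  shows "((\<lambda>x. G x * oddcos j x * cos (2 * pi * x) ^ n) has_integral 0) {-1/2..1/2}"
proof (induction n arbitrary: j)
  case 0
  have "(\<lambda>x. G x * oddcos j x) integrable_on {-1/2..1/2}"
    by (intro integrable_continuous_interval continuous_intros cont)
  with zero[of j] show ?case by (simp add: oddcos_coeff_def has_integral_integrable_integral)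
next
  case (Suc n)
  \<comment> \<open>The neighbour below \<open>j = 0\<close> has frequency \<open>-1\<close>, and its cosine is again \<open>oddcos 0\<close>.\<close>
  define i where "i = (if j = 0 then 0 else j - 1)"
  have step: "oddcos j x * cos (2 * pi * x) = (oddcos (Suc j) x + oddcos i x) / 2" for x
  proof -
    have "oddcos i x = cos (real (2 * j + 1) * pi * x - 2 * pi * x)"
    proof (cases "j = 0")
      case True
      then show ?thesis using cos_minus[of "pi * x"] by (simp add: i_def oddcos_def)
    next
      case False
      then show ?thesis by (simp add: i_def oddcos_def of_nat_diff algebra_simps)
    qed
    moreover have "oddcos (Suc j) x = cos (real (2 * j + 1) * pi * x + 2 * pi * x)"
      by (simp add: oddcos_def algebra_simps)
    ultimately show ?thesis
      by (simp add: oddcos_def cos_times_cos)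
  qed
  have eq: "G x * oddcos j x * cos (2 * pi * x) ^ Suc n =
      (G x * oddcos (Suc j) x * cos (2 * pi * x) ^ n + G x * oddcos i x * cos (2 * pi * x) ^ n) / 2" for x
    using arg_cong[OF step, of "\<lambda>t. G x * t * cos (2 * pi * x) ^ n" x]
    by (simp add: algebra_simps add_divide_distrib)
  show ?case
    unfolding eq using has_integral_divide[OF has_integral_add[OF Suc.IH Suc.IH], of "Suc j" i 2] by simp
qed

text \<open>
  An even function is a function of \<open>cos (2 \<pi> x)\<close> on this interval. Thus \<open>H(x) = G(x) cos (\<pi> x)\<close>
  is a uniform limit of polynomials in \<open>cos (2 \<pi> x)\<close>; as \<open>H\<close> is orthogonal to all of these, it is
  orthogonal to itself. The conclusion is restricted to the open interval because \<open>cos (\<pi> x)\<close>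
  vanishes at the endpoints.
\<close>
lemma oddcos_complete:
  assumes cont: "continuous_on {-1/2..1/2} G"
    and even: "\<And>x. x \<in> {-1/2..1/2} \<Longrightarrow> G (- x) = G x"
    and zero: "\<And>j. oddcos_coeff G j = 0"
    and x: "x \<in> {-1/2<..<1/2}"
  shows "G x = 0"
proof -
  define H where "H = (\<lambda>x. G x * oddcos 0 x)"
  have contH: "continuous_on {-1/2..1/2} H"
    unfolding H_def by (intro continuous_intros cont)
  define \<phi> where "\<phi> = (\<lambda>c. H (arccos c / (2 * pi)))"
  have \<phi>_cos: "\<phi> (cos (2 * pi * x)) = H x" if "x \<in> {-1/2..1/2}" for x
  proof -
    have "cos (2 * pi * x) = cos (2 * pi * \<bar>x\<bar>)"
      by (cases "x \<ge> 0") auto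
    moreover have "arccos (cos (2 * pi * \<bar>x\<bar>)) = 2 * pi * \<bar>x\<bar>"
      using that by (intro arccos_cos) (auto simp: abs_le_iff)
    moreover have "H \<bar>x\<bar> = H x"
      using even[OF that] by (cases "x \<ge> 0") (auto simp: H_def)
    ultimately show ?thesis by (simp add: \<phi>_def)
  qed
  have cont\<phi>: "continuous_on {-1..1} \<phi>"
    unfolding \<phi>_def
  proof (rule continuous_on_compose2[OF contH])
    show "continuous_on {-1..1} (\<lambda>c. arccos c / (2 * pi))"
      by (intro continuous_intros continuous_on_arccos) auto
    show "(\<lambda>c. arccos c / (2 * pi)) ` {-1..1} \<subseteq> {-1/2..1/2}"
    proof (rule image_subsetI)
      fix c :: real assume "c \<in> {-1..1}"
      then have "0 \<le> arccos c" "arccos c \<le> pi"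
        using arccos_bounded[of c] by auto
      then show "arccos c / (2 * pi) \<in> {-1/2..1/2}"
        by (auto simp: field_simps intro: order_trans[of _ 0])
    qed
  qed
  obtain B where B: "\<And>x. x \<in> {-1/2..1/2} \<Longrightarrow> \<bar>H x\<bar> \<le> B"
    using compact_imp_bounded[OF compact_continuous_image[OF contH compact_Icc]]
    unfolding bounded_iff by (metis imageI real_norm_def)
  have B0: "0 \<le> B" using B[of 0] by auto
  have intHH: "(\<lambda>x. H x * H x) integrable_on {-1/2..1/2}"
    by (intro integrable_continuous_interval continuous_intros contH)
  have small: "integral {-1/2..1/2} (\<lambda>x. H x * H x) \<le> B * e" if e: "e > 0" for e
  proof -
    obtain p where p: "real_polynomial_function p" "\<And>c. c \<in> {-1..1} \<Longrightarrow> \<bar>\<phi> c - p c\<bar> < e"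
      using Stone_Weierstrass_real_polynomial_function[OF compact_Icc cont\<phi> e] by blast
    then obtain a n where pe: "p = (\<lambda>c. \<Sum>i\<le>n. a i * c ^ i)"
      unfolding real_polynomial_function_iff_sum by blast
    have "((\<lambda>x. \<Sum>i\<le>n. a i * (G x * oddcos 0 x * cos (2 * pi * x) ^ i)) has_integral (\<Sum>i\<le>n. a i * 0)) {-1/2..1/2}"
      by (intro has_integral_sum has_integral_mult_right oddcos_moments_zero cont zero) auto
    then have int0: "((\<lambda>x. H x * p (cos (2 * pi * x))) has_integral 0) {-1/2..1/2}"
      by (simp add: pe H_def sum_distrib_left mult_ac)
    have "((\<lambda>x. H x * H x - H x * p (cos (2 * pi * x))) has_integral
        integral {-1/2..1/2} (\<lambda>x. H x * H x) - 0) {-1/2..1/2}"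
      by (intro has_integral_diff int0 integrable_integral intHH)
    moreover have "((\<lambda>x. B * e) has_integral B * e) {-1/2..1/2::real}"
      using has_integral_const_real[of "B * e" "-1/2" "1/2"] by simp
    ultimately have "integral {-1/2..1/2} (\<lambda>x. H x * H x) - 0 \<le> B * e"
    proof (rule has_integral_le)
      fix x :: real assume x: "x \<in> {-1/2..1/2}"
      have "\<bar>H x - p (cos (2 * pi * x))\<bar> \<le> e"
        using p(2)[of "cos (2 * pi * x)"] \<phi>_cos[OF x] by simp
      with B[OF x] B0 have "\<bar>H x * (H x - p (cos (2 * pi * x)))\<bar> \<le> B * e"
        unfolding abs_mult by (intro mult_mono) auto
      then show "H x * H x - H x * p (cos (2 * pi * x)) \<le> B * e"
        by (simp add: right_diff_distrib)
    qed
    then show ?thesis by simp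
  qed
  have "integral {-1/2..1/2} (\<lambda>x. H x * H x) \<le> 0"
  proof (rule field_le_epsilon)
    fix e :: real assume "e > 0"
    then have "integral {-1/2..1/2} (\<lambda>x. H x * H x) \<le> B * (e / (B + 1))"
      using B0 by (intro small) auto
    also have "\<dots> \<le> 0 + e"
      using B0 \<open>e > 0\<close> by (simp add: field_simps)
    finally show "integral {-1/2..1/2} (\<lambda>x. H x * H x) \<le> 0 + e" .
  qed
  moreover have "integral {-1/2..1/2} (\<lambda>x. H x * H x) \<ge> 0"
    by (intro integral_nonneg intHH) auto
  ultimately have "integral {-1/2..1/2} (\<lambda>x. H x * H x) = 0" by simp
  moreover have "continuous_on {-1/2..1/2} (\<lambda>x. H x * H x)"
    by (intro continuous_intros contH)
  ultimately have "\<forall>x\<in>{-1/2..1/2}. H x * H x = 0"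
    by (subst (asm) integral_eq_0_iff) auto
  moreover have "x \<in> {-1/2..1/2}" using x by auto
  ultimately have "H x = 0" by simp
  moreover have "pi * (-1/2) < pi * x" "pi * x < pi * (1/2)"
    using x by (intro mult_strict_left_mono; simp)+
  then have "oddcos 0 x > 0"
    unfolding oddcos_def by (intro cos_gt_zero_pi) simp_all
  ultimately show ?thesis by (simp add: H_def)
qed

text \<open>
  Absolute summability of the coefficients of \<open>w\<close> makes its series \<open>W\<close> converge uniformly, so \<open>W\<close> is
  continuous and can be integrated termwise against any continuous function. Against the basis this
  gives \<open>W\<close> the same coefficients as \<open>w\<close>, whence \<open>W = w\<close> by completeness; against \<open>g\<close> it gives the claim.
\<close>
lemma parseval_oddcos:
  assumes contw: "continuous_on {-1/2..1/2} w"
    and even: "\<And>x. x \<in> {-1/2..1/2} \<Longrightarrow> w (- x) = w x"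
    and summ: "summable (\<lambda>j. \<bar>oddcos_coeff w j\<bar>)"
    and contg: "continuous_on {-1/2..1/2} g"
  shows "(\<lambda>j. 2 * oddcos_coeff w j * oddcos_coeff g j) sums integral {-1/2..1/2} (\<lambda>x. w x * g x)"
proof -
  define S where "S = (\<lambda>N x. \<Sum>j<N. 2 * oddcos_coeff w j * oddcos j x)"
  define W where "W = (\<lambda>x. \<Sum>j. 2 * oddcos_coeff w j * oddcos j x)"
  have ul: "uniform_limit {-1/2..1/2} S W sequentially"
    unfolding S_def W_def
  proof (rule Weierstrass_m_test)
    show "summable (\<lambda>j. 2 * \<bar>oddcos_coeff w j\<bar>)" by (intro summable_mult summ)
    show "norm (2 * oddcos_coeff w j * oddcos j x) \<le> 2 * \<bar>oddcos_coeff w j\<bar>" for j x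
      using mult_left_mono[OF abs_oddcos_le[of j x], of "\<bar>oddcos_coeff w j\<bar>"] by (simp add: abs_mult)
  qed
  have contS: "continuous_on {-1/2..1/2} (S N)" for N
    unfolding S_def by (intro continuous_intros)
  have contW: "continuous_on {-1/2..1/2} W"
    by (rule uniform_limit_theorem[OF always_eventually ul]) (simp_all only: contS trivial_limit_sequentially not_False_eq_True simp_thms)
  have series: "(\<lambda>j. 2 * oddcos_coeff w j * oddcos_coeff h j) sums integral {-1/2..1/2} (\<lambda>x. W x * h x)"
    if conth: "continuous_on {-1/2..1/2} h" for h
  proof -
    have bounded: "bounded (u ` {-1/2..1/2})" if "continuous_on {-1/2..1/2} u" for u :: "real \<Rightarrow> real"
      by (intro compact_imp_bounded compact_continuous_image that compact_Icc)
    have "uniform_limit {-1/2..1/2} (\<lambda>N x. S N x * h x) (\<lambda>x. W x * h x) sequentially"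
      by (intro bounded_bilinear.bounded_uniform_limit[OF bounded_bilinear_mult]
            uniform_limit_const ul bounded contW conth)
    from uniform_limit_integral[OF this continuous_on_mult[OF contS conth] trivial_limit_sequentially]
    obtain I J where
      IJ: "\<And>N. ((\<lambda>x. S N x * h x) has_integral I N) {-1/2..1/2}"
        "((\<lambda>x. W x * h x) has_integral J) {-1/2..1/2}" "I \<longlonglongrightarrow> J"
      by blast
    have "I N = (\<Sum>j<N. 2 * oddcos_coeff w j * oddcos_coeff h j)" for N
    proof -
      have "((\<lambda>x. \<Sum>j<N. 2 * oddcos_coeff w j * (h x * oddcos j x)) has_integral
          (\<Sum>j<N. 2 * oddcos_coeff w j * oddcos_coeff h j)) {-1/2..1/2}"
        unfolding oddcos_coeff_def[of h]
        by (intro has_integral_sum has_integral_mult_right integrable_integral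
              integrable_continuous_interval continuous_intros conth) auto
      moreover have "(\<lambda>x. \<Sum>j<N. 2 * oddcos_coeff w j * (h x * oddcos j x)) = (\<lambda>x. S N x * h x)"
        by (simp add: S_def sum_distrib_left sum_distrib_right mult_ac)
      ultimately show ?thesis using IJ(1) by (metis has_integral_unique)
    qed
    then have "I = (\<lambda>N. \<Sum>j<N. 2 * oddcos_coeff w j * oddcos_coeff h j)" by blast
    with IJ(2,3) show ?thesis by (simp add: sums_def integral_unique)
  qed
  have "oddcos_coeff (\<lambda>x. w x - W x) k = 0" for k
  proof -
    have "(\<lambda>j. 2 * oddcos_coeff w j * oddcos_coeff (oddcos k) j) sums oddcos_coeff W k"
      using series[of "oddcos k"] by (simp add: oddcos_coeff_def[of W] continuous_intros)
    moreover have "(\<lambda>j. 2 * oddcos_coeff w j * oddcos_coeff (oddcos k) j)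
        = (\<lambda>j. if j = k then oddcos_coeff w j else 0)"
      by (auto simp: oddcos_orthogonal)
    ultimately have "oddcos_coeff W k = oddcos_coeff w k"
      using sums_single[of k "oddcos_coeff w"] sums_unique2 by metis
    then show ?thesis using oddcos_coeff_diff[OF contw contW, of k] by simp
  qed
  moreover have "W (- x) = W x" for x by (simp add: W_def)
  ultimately have "w x - W x = 0" if "x \<in> {-1/2<..<1/2}" for x
    using that even by (intro oddcos_complete[of "\<lambda>x. w x - W x"] continuous_intros contw contW) auto
  then have "integral {-1/2<..<1/2} (\<lambda>x. W x * g x) = integral {-1/2<..<1/2} (\<lambda>x. w x * g x)"
    by (intro Henstock_Kurzweil_Integration.integral_cong) auto
  with series[OF contg] show ?thesis
    by (simp add: integral_open_interval_real)
qed

section \<open>Cosine coefficients of the power weights\<close>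

definition half_moment :: "nat \<Rightarrow> nat \<Rightarrow> real" where
  "half_moment j m = integral {0..1/2} (\<lambda>x. (2 * x) ^ m * oddcos j x)"

lemma half_moment_integrable: "(\<lambda>x. (2 * x) ^ m * oddcos j x) integrable_on {0..1/2}"
  by (intro integrable_continuous_interval continuous_intros)

lemma half_moment_0: "half_moment j 0 = (-1) ^ j / (real (2 * j + 1) * pi)"
proof -
  define \<mu> where "\<mu> = real (2 * j + 1) * pi"
  have \<mu>: "\<mu> \<noteq> 0" by (simp add: \<mu>_def)
  have "((\<lambda>x. cos (\<mu> * x)) has_integral (sin (\<mu> * (1/2)) / \<mu> - sin (\<mu> * 0) / \<mu>)) {0..1/2}"
    by (rule fundamental_theorem_of_calculus)
       (use \<mu> in \<open>auto intro!: derivative_eq_intros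
          simp flip: has_real_derivative_iff_has_vector_derivative\<close>)
  moreover have "sin (\<mu> / 2) = (-1) ^ j"
    unfolding \<mu>_def by (rule sin_odd_half_pi)
  ultimately show ?thesis
    unfolding half_moment_def oddcos_def \<mu>_def[symmetric] by (simp add: integral_unique)
qed

lemma half_moment_1:
  "half_moment j 1 = (-1) ^ j / (real (2 * j + 1) * pi) - 2 / (real (2 * j + 1) * pi)\<^sup>2"
proof -
  define \<mu> where "\<mu> = real (2 * j + 1) * pi"
  define r where "r = 1 / \<mu>"
  have r: "\<mu> * r = 1" by (simp add: \<mu>_def r_def)
  define F where "F x = 2 * x * sin (\<mu> * x) * r + 2 * cos (\<mu> * x) * r\<^sup>2" for x
  have "((\<lambda>x. 2 * x * cos (\<mu> * x)) has_integral (F (1/2) - F 0)) {0..1/2}"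
  proof (rule fundamental_theorem_of_calculus)
    fix x :: real
    have "(F has_real_derivative (2 * sin (\<mu> * x) + 2 * x * (\<mu> * cos (\<mu> * x))) * r
        - 2 * (\<mu> * sin (\<mu> * x)) * r\<^sup>2) (at x within {0..1/2})"
      unfolding F_def by (auto intro!: derivative_eq_intros simp: algebra_simps)
    also have "(2 * sin (\<mu> * x) + 2 * x * (\<mu> * cos (\<mu> * x))) * r
        - 2 * (\<mu> * sin (\<mu> * x)) * r\<^sup>2 = 2 * x * cos (\<mu> * x)"
      using r by algebra
    finally show "(F has_vector_derivative 2 * x * cos (\<mu> * x)) (at x within {0..1/2})"
      by (simp add: has_real_derivative_iff_has_vector_derivative)
  qed simp
  moreover have "sin (\<mu> / 2) = (-1) ^ j" "cos (\<mu> / 2) = 0"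
    unfolding \<mu>_def by (rule sin_odd_half_pi cos_odd_half_pi)+
  ultimately show ?thesis
    unfolding half_moment_def oddcos_def \<mu>_def[symmetric]
    by (simp add: integral_unique F_def r_def power_divide)
qed

text \<open>
  Two integrations by parts. The function \<open>F\<close> below is the antiderivative that they produce; it
  vanishes at \<open>0\<close>, and at \<open>1/2\<close> only its sine term survives.
\<close>
lemma half_moment_Suc_Suc:
  "half_moment j (Suc (Suc m)) = (-1) ^ j / (real (2 * j + 1) * pi)
     - 4 * real (m + 2) * real (m + 1) / (real (2 * j + 1) * pi)\<^sup>2 * half_moment j m"
proof -
  define \<mu> where "\<mu> = real (2 * j + 1) * pi"
  define r where "r = 1 / \<mu>"
  have r: "\<mu> * r = 1" by (simp add: \<mu>_def r_def)
  define a b where "a = real (m + 2)" and "b = real (m + 1)"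
  define F where "F x = (2 * x) ^ (m + 2) * sin (\<mu> * x) * r
      + 2 * a * ((2 * x) ^ (m + 1) * cos (\<mu> * x)) * r\<^sup>2" for x
  define F' where "F' x = (2 * x) ^ (m + 2) * oddcos j x
      + 4 * a * b * r\<^sup>2 * ((2 * x) ^ m * oddcos j x)" for x
  have "(F' has_integral (F (1/2) - F 0)) {0..1/2}"
  proof (rule fundamental_theorem_of_calculus)
    fix x :: real
    define P Q R where "P = (2 * x) ^ (m + 2)" and "Q = (2 * x) ^ (m + 1)" and "R = (2 * x) ^ m"
    have P: "((\<lambda>x. (2 * x) ^ (m + 2)) has_real_derivative a * (2 * Q)) (at x within {0..1/2})"
      by (rule derivative_eq_intros refl)+ (simp add: a_def Q_def)
    have Q: "((\<lambda>x. (2 * x) ^ (m + 1)) has_real_derivative b * (2 * R)) (at x within {0..1/2})"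
      by (rule derivative_eq_intros refl)+ (simp add: b_def R_def)
    have sin: "((\<lambda>x. sin (\<mu> * x)) has_real_derivative \<mu> * cos (\<mu> * x)) (at x within {0..1/2})"
      and cos: "((\<lambda>x. cos (\<mu> * x)) has_real_derivative - (\<mu> * sin (\<mu> * x))) (at x within {0..1/2})"
      by (auto intro!: derivative_eq_intros)
    have "(F has_real_derivative
        (a * (2 * Q) * sin (\<mu> * x) + \<mu> * cos (\<mu> * x) * P) * r
        + 2 * a * (b * (2 * R) * cos (\<mu> * x) + - (\<mu> * sin (\<mu> * x)) * Q) * r\<^sup>2) (at x within {0..1/2})"
      unfolding F_def P_def Q_def
      by (intro DERIV_add DERIV_cmult_right DERIV_cmult DERIV_mult
            P[unfolded Q_def] Q sin cos)
    also have "(a * (2 * Q) * sin (\<mu> * x) + \<mu> * cos (\<mu> * x) * P) * r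
        + 2 * a * (b * (2 * R) * cos (\<mu> * x) + - (\<mu> * sin (\<mu> * x)) * Q) * r\<^sup>2
        = P * cos (\<mu> * x) + 4 * a * b * r\<^sup>2 * (R * cos (\<mu> * x))"
      using r by algebra
    also have "\<dots> = F' x"
      unfolding F'_def P_def R_def oddcos_def \<mu>_def ..
    finally show "(F has_vector_derivative F' x) (at x within {0..1/2})"
      by (simp add: has_real_derivative_iff_has_vector_derivative)
  qed simp
  moreover have "sin (\<mu> / 2) = (-1) ^ j" "cos (\<mu> / 2) = 0"
    unfolding \<mu>_def by (rule sin_odd_half_pi cos_odd_half_pi)+
  ultimately have "(F' has_integral (-1) ^ j * r) {0..1/2}"
    by (simp add: F_def)
  moreover have "(F' has_integral (half_moment j (m + 2) + 4 * a * b * r\<^sup>2 * half_moment j m)) {0..1/2}"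
    unfolding F'_def half_moment_def
    by (intro has_integral_add has_integral_mult_right integrable_integral half_moment_integrable)
  ultimately have "half_moment j (m + 2) + 4 * a * b * r\<^sup>2 * half_moment j m = (-1) ^ j * r"
    by (rule has_integral_unique[symmetric])
  then show ?thesis
    unfolding \<mu>_def[symmetric] a_def[symmetric] b_def[symmetric]
    by (simp add: r_def power_divide algebra_simps)
qed

lemma abs_half_moment_le: "\<bar>half_moment j m\<bar> \<le> 1"
proof -
  have "norm (half_moment j m) \<le> 1 * measure lborel {0..1/2::real}"
    unfolding half_moment_def
  proof (rule has_integral_bound_real[OF _ finite.emptyI integrable_integral[OF half_moment_integrable]])
    fix x :: real assume "x \<in> {0..1/2} - {}"
    then have "\<bar>(2 * x) ^ m\<bar> \<le> 1" using power_le_one[of "2 * x" m] by simp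
    then have "\<bar>(2 * x) ^ m\<bar> * \<bar>oddcos j x\<bar> \<le> 1 * 1"
      using abs_oddcos_le by (intro mult_mono) auto
    then show "norm ((2 * x) ^ m * oddcos j x) \<le> 1" by (simp add: abs_mult)
  qed auto
  then show ?thesis by simp
qed

text \<open>
  For \<open>j = 0\<close> the integrand is nonnegative. For \<open>j \<ge> 1\<close> the frequency \<open>\<mu> = (2j+1) \<pi>\<close> is at least \<open>9\<close>,
  so in the recursion, normalised by \<open>c\<^sub>k = (-1)\<^sup>j \<mu> half_moment j k\<close> to
  \<open>c\<^sub>k = 1 - 4k(k-1)/\<mu>\<^sup>2 c\<^bsub>k-2\<^esub>\<close>, the term \<open>1\<close> dominates: the factor
  \<open>4k(k-1)/\<mu>\<^sup>2\<close> is at most \<open>24/81\<close> for \<open>k \<le> 3\<close> and at most \<open>48/81\<close> for \<open>k = 4\<close>, while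
  \<open>c\<^sub>0 = 1\<close>, \<open>c\<^sub>1 \<le> 2\<close> and \<open>c\<^sub>2 \<le> 1\<close>.
\<close>
lemma half_moment_alternating:
  assumes "m \<le> 4"
  shows "0 \<le> (-1) ^ j * half_moment j m"
proof (cases "j = 0")
  case True
  have "0 \<le> half_moment 0 m"
    unfolding half_moment_def
  proof (rule integral_nonneg[OF half_moment_integrable])
    fix x :: real assume x: "x \<in> {0..1/2}"
    then have "0 \<le> oddcos 0 x"
      unfolding oddcos_def by (intro cos_ge_zero) (auto simp: field_simps intro: order_trans[of _ 0])
    with x show "0 \<le> (2 * x) ^ m * oddcos 0 x" by simp
  qed
  with True show ?thesis by simp
next
  case False
  define \<mu> where "\<mu> = real (2 * j + 1) * pi"
  have "3 * 3 \<le> real (2 * j + 1) * pi"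
    using False pi_gt3 by (intro mult_mono) auto
  then have \<mu>: "9 \<le> \<mu>" by (simp add: \<mu>_def)
  define q where "q = 4 / \<mu>\<^sup>2"
  have q: "0 \<le> q" "q \<le> 4 / 81"
    using power_mono[OF \<mu>, of 2] \<mu> by (simp_all add: q_def field_simps)
  have sq: "(-1) ^ j * (-1) ^ j = (1::real)" by (simp flip: power_mult_distrib)
  define c where "c k = \<mu> * ((-1) ^ j * half_moment j k)" for k
  have c0: "c 0 = 1"
    unfolding c_def half_moment_0 \<mu>_def[symmetric] using \<mu> sq by simp
  have "c 1 = 1 - 2 * (-1) ^ j / \<mu>"
    using \<mu> sq unfolding c_def half_moment_1 \<mu>_def[symmetric]
    by (simp add: field_simps power2_eq_square)
  moreover have "\<bar>2 * (-1) ^ j / \<mu>\<bar> \<le> 2 / 9"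
    using \<mu> by (simp add: abs_mult power_abs field_simps)
  ultimately have c1: "0 \<le> c 1" "c 1 \<le> 2" by linarith+
  have rec: "c (Suc (Suc k)) = 1 - q * (real (k + 2) * real (k + 1)) * c k" for k
  proof -
    have "\<mu> * (s * (s / \<mu> - 4 * a * b / \<mu>\<^sup>2 * h)) = s * s * (\<mu> / \<mu>) - 4 / \<mu>\<^sup>2 * (a * b) * (\<mu> * (s * h))"
      for s a b h by (simp add: right_diff_distrib mult_ac)
    then show ?thesis
      unfolding c_def half_moment_Suc_Suc \<mu>_def[symmetric] q_def using \<mu> by (simp only: sq) simp
  qed
  have c2: "c 2 = 1 - 2 * q"
    using rec[of 0] c0 by (simp add: numeral_2_eq_2)
  have c3: "c 3 = 1 - q * 6 * c 1"
    using rec[of 1] by (simp add: numeral_3_eq_3)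
  have c4: "c 4 = 1 - q * 12 * c 2"
    using rec[of 2] by (simp add: eval_nat_numeral)
  have "q * c 1 \<le> 4 / 81 * 2"
    using q c1 by (intro mult_mono) auto
  then have "0 \<le> c 3" using c3 by simp
  have "q * c 2 \<le> 4 / 81 * 1"
    using q c2 by (intro mult_mono) auto
  then have "0 \<le> c 4" using c4 by simp
  have "m = 0 \<or> m = 1 \<or> m = 2 \<or> m = 3 \<or> m = 4" using assms by linarith
  then have "0 \<le> c m" using c0 c1 c2 q \<open>0 \<le> c 3\<close> \<open>0 \<le> c 4\<close> by auto
  then show ?thesis using \<mu> by (simp add: c_def zero_le_mult_iff)
qed

lemma integral_even:
  fixes h :: "real \<Rightarrow> real"
  assumes "continuous_on {-1/2..1/2} h" "\<And>x. x \<in> {-1/2..1/2} \<Longrightarrow> h (- x) = h x"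
  shows "integral {-1/2..1/2} h = 2 * integral {0..1/2} h"
proof -
  have "integral {-1/2..1/2} h = integral {-1/2..0} h + integral {0..1/2} h"
    by (rule Henstock_Kurzweil_Integration.integral_combine
          [OF _ _ integrable_continuous_interval[OF assms(1)], symmetric]) simp_all
  also have "integral {-1/2..0} h = integral {-1/2..0} (\<lambda>x. h (- x))"
    by (rule Henstock_Kurzweil_Integration.integral_cong) (use assms(2) in auto)
  also have "\<dots> = integral {0..1/2} h"
    using Henstock_Kurzweil_Integration.integral_reflect_real[of "1/2" 0 h] by simp
  finally show ?thesis by simp
qed

text \<open>
  The recursion for \<open>half_moment\<close> cancels the boundary terms, which leaves the decay of order
  \<open>1/j\<^sup>2\<close> and reduces the sign of the coefficient to that of a lower moment.
\<close>
lemma oddcos_coeff_power_weight: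
  "oddcos_coeff (\<lambda>x. 1 - \<bar>2 * x\<bar> ^ Suc (Suc m)) j
     = 8 * real (m + 2) * real (m + 1) / (real (2 * j + 1) * pi)\<^sup>2 * half_moment j m"
proof -
  have "oddcos_coeff (\<lambda>x. 1 - \<bar>2 * x\<bar> ^ Suc (Suc m)) j
      = 2 * integral {0..1/2} (\<lambda>x. (1 - \<bar>2 * x\<bar> ^ Suc (Suc m)) * oddcos j x)"
    unfolding oddcos_coeff_def by (rule integral_even) (auto intro!: continuous_intros)
  also have "integral {0..1/2} (\<lambda>x. (1 - \<bar>2 * x\<bar> ^ Suc (Suc m)) * oddcos j x)
      = integral {0..1/2} (\<lambda>x. (2 * x) ^ 0 * oddcos j x - (2 * x) ^ Suc (Suc m) * oddcos j x)"
    by (rule Henstock_Kurzweil_Integration.integral_cong) (auto simp: algebra_simps)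
  also have "\<dots> = half_moment j 0 - half_moment j (Suc (Suc m))"
    unfolding half_moment_def
    by (intro Henstock_Kurzweil_Integration.integral_diff half_moment_integrable)
  finally show ?thesis by (simp add: half_moment_0 half_moment_Suc_Suc)
qed

lemma summable_oddcos_coeff_power_weight:
  "summable (\<lambda>j. \<bar>oddcos_coeff (\<lambda>x. 1 - \<bar>2 * x\<bar> ^ Suc (Suc m)) j\<bar>)"
proof (rule summable_comparison_test')
  define K where "K = 8 * real (m + 2) * real (m + 1)"
  show "summable (\<lambda>j. K * (1 / real (Suc j) ^ 2))"
    by (intro summable_mult) (use inverse_power_summable[of 2, where ?'a = real] in
        \<open>simp only: summable_Suc_iff[of "\<lambda>n. 1 / real n ^ 2"] inverse_eq_divide of_nat_numeral; simp\<close>)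
  fix j :: nat
  have "real (Suc j) * 1 \<le> real (2 * j + 1) * pi"
    using pi_gt3 by (intro mult_mono) auto
  then have "real (Suc j) ^ 2 \<le> (real (2 * j + 1) * pi) ^ 2"
    by (intro power_mono) auto
  then have "K / (real (2 * j + 1) * pi)\<^sup>2 * \<bar>half_moment j m\<bar> \<le> K / real (Suc j) ^ 2 * 1"
    by (intro mult_mono divide_left_mono abs_half_moment_le) (auto simp: K_def)
  then show "norm \<bar>oddcos_coeff (\<lambda>x. 1 - \<bar>2 * x\<bar> ^ Suc (Suc m)) j\<bar> \<le> K * (1 / real (Suc j) ^ 2)"
    unfolding oddcos_coeff_power_weight K_def[symmetric] by (simp add: abs_mult K_def)
qed

lemma integral_power_weight:
  "integral {-1/2..1/2} (\<lambda>x::real. 1 - \<bar>2 * x\<bar> ^ n) = real n / (real n + 1)"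
proof -
  define F where "F x = x - (2 * x) ^ Suc n / (2 * real (Suc n))" for x :: real
  have "((\<lambda>x::real. 1 - (2 * x) ^ n) has_integral (F (1/2) - F 0)) {0..1/2}"
  proof (rule fundamental_theorem_of_calculus)
    fix x :: real
    have power: "((\<lambda>x. (2 * x) ^ Suc n) has_real_derivative real (Suc n) * (2 * (2 * x) ^ n)) (at x within {0..1/2})"
      by (rule derivative_eq_intros refl)+ simp
    have "(F has_real_derivative 1 - real (Suc n) * (2 * (2 * x) ^ n) / (2 * real (Suc n))) (at x within {0..1/2})"
      unfolding F_def by (intro DERIV_diff DERIV_ident DERIV_cdivide power)
    also have "1 - real (Suc n) * (2 * (2 * x) ^ n) / (2 * real (Suc n)) = 1 - (2 * x) ^ n"
      by (simp del: of_nat_Suc)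
    finally show "(F has_vector_derivative 1 - (2 * x) ^ n) (at x within {0..1/2})"
      by (simp add: has_real_derivative_iff_has_vector_derivative)
  qed simp
  then have "integral {0..1/2} (\<lambda>x::real. 1 - (2 * x) ^ n) = F (1/2) - F 0"
    by (rule integral_unique)
  moreover have "integral {-1/2..1/2} (\<lambda>x::real. 1 - \<bar>2 * x\<bar> ^ n) = 2 * integral {0..1/2} (\<lambda>x::real. 1 - \<bar>2 * x\<bar> ^ n)"
    by (rule integral_even) (auto intro!: continuous_intros)
  moreover have "integral {0..1/2} (\<lambda>x::real. 1 - \<bar>2 * x\<bar> ^ n) = integral {0..1/2} (\<lambda>x::real. 1 - (2 * x) ^ n)"
    by (rule Henstock_Kurzweil_Integration.integral_cong) auto
  ultimately show ?thesis by (simp add: F_def field_simps)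
qed

section \<open>The Fourier transform at half-odd frequencies\<close>

lemma Re_fourier_half_odd:
  assumes "continuous_on {-1/2..1/2} f"
  shows "Re (fourier f (real j + 1/2)) = oddcos_coeff f j"
proof -
  define h where "h x = complex_of_real (f x) *
    exp (- 2 * complex_of_real pi * \<i> * complex_of_real ((real j + 1/2) * x))" for x
  have "h integrable_on {-1/2..1/2}"
    unfolding h_def by (intro integrable_continuous_interval continuous_intros assms)
  then have "Re (integral {-1/2..1/2} h) = integral {-1/2..1/2} (Re \<circ> h)"
    by (intro integral_linear[symmetric] bounded_linear_Re)
  moreover have "Re \<circ> h = (\<lambda>x. f x * oddcos j x)"
  proof
    fix x :: real
    have "- 2 * complex_of_real pi * \<i> * complex_of_real ((real j + 1/2) * x)
        = \<i> * complex_of_real (- (real (2 * j + 1) * pi * x))"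
      by (simp add: algebra_simps)
    then show "(Re \<circ> h) x = f x * oddcos j x"
      unfolding h_def o_def by (simp only: exp_Euler) (simp add: oddcos_def Re_exp cos_of_real sin_of_real del: of_real_minus of_real_mult)
  qed
  ultimately show ?thesis by (simp add: fourier_def h_def[abs_def] oddcos_coeff_def)
qed

lemma smooth_imp_C1:
  assumes "smooth_on_interval a b f"
  obtains f' where "\<And>x. x \<in> {a..b} \<Longrightarrow> (f has_real_derivative f' x) (at x within {a..b})"
    "continuous_on {a..b} f'"
proof -
  from assms obtain D where D: "\<forall>x\<in>{a..b}. D 0 x = f x"
    "\<forall>n. \<forall>x\<in>{a..b}. (D n has_real_derivative D (Suc n) x) (at x within {a..b})"
    unfolding smooth_on_interval_def by blast
  show thesis
  proof
    show "(f has_real_derivative D 1 x) (at x within {a..b})" if "x \<in> {a..b}" for x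
    proof (rule has_field_derivative_transform_within[OF _ zero_less_one that])
      show "(D 0 has_real_derivative D 1 x) (at x within {a..b})" using D(2) that by simp
    qed (use D(1) in simp)
    show "continuous_on {a..b} (D 1)"
      by (rule DERIV_continuous_on) (rule D(2)[rule_format])
  qed
qed

text \<open>
  One integration by parts. The bound makes the supremum and the infimum in \<open>max_fourier\<close> range
  over bounded families; on unbounded ones \<open>SUP\<close> and \<open>INF\<close> over the reals carry no information.
\<close>
lemma oddcos_coeff_decay:
  assumes der: "\<And>x. x \<in> {-1/2..1/2} \<Longrightarrow> (f has_real_derivative f' x) (at x within {-1/2..1/2})"
    and cont: "continuous_on {-1/2..1/2} f'"
  obtains K where "\<And>j. \<bar>(real j + 1/2) * oddcos_coeff f j\<bar> \<le> K"
proof -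
  obtain B where B: "\<And>x. x \<in> {-1/2..1/2} \<Longrightarrow> \<bar>f' x\<bar> \<le> B"
    using compact_imp_bounded[OF compact_continuous_image[OF cont compact_Icc]]
    unfolding bounded_iff by (metis imageI real_norm_def)
  have B0: "0 \<le> B" using B[of 0] by auto
  have contf: "continuous_on {-1/2..1/2} f" by (rule DERIV_continuous_on) (rule der)
  show thesis
  proof
    fix j
    define \<mu> where "\<mu> = real (2 * j + 1) * pi"
    define R where "R = integral {-1/2..1/2} (\<lambda>x. f' x * sin (\<mu> * x))"
    have "((\<lambda>x. f' x * sin (\<mu> * x) + \<mu> * (f x * oddcos j x)) has_integral
        f (1/2) * sin (\<mu> * (1/2)) - f (-1/2) * sin (\<mu> * (-1/2))) {-1/2..1/2}"
    proof (rule fundamental_theorem_of_calculus)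
      fix x :: real assume x: "x \<in> {-1/2..1/2}"
      have "((\<lambda>x. sin (\<mu> * x)) has_real_derivative \<mu> * oddcos j x) (at x within {-1/2..1/2})"
        by (auto intro!: derivative_eq_intros simp: oddcos_def \<mu>_def)
      from DERIV_mult[OF der[OF x] this]
      show "((\<lambda>x. f x * sin (\<mu> * x)) has_vector_derivative
          f' x * sin (\<mu> * x) + \<mu> * (f x * oddcos j x)) (at x within {-1/2..1/2})"
        by (simp add: mult_ac flip: has_real_derivative_iff_has_vector_derivative)
    qed simp
    moreover have "((\<lambda>x. f' x * sin (\<mu> * x) + \<mu> * (f x * oddcos j x)) has_integral
        R + \<mu> * oddcos_coeff f j) {-1/2..1/2}"
      unfolding R_def oddcos_coeff_def
      by (intro has_integral_add has_integral_mult_right integrable_integral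
            integrable_continuous_interval continuous_intros cont contf)
    ultimately have "R + \<mu> * oddcos_coeff f j = f (1/2) * sin (\<mu> * (1/2)) - f (-1/2) * sin (\<mu> * (-1/2))"
      by (rule has_integral_unique[symmetric])
    moreover have "\<bar>f (1/2) * sin (\<mu> * (1/2))\<bar> \<le> \<bar>f (1/2)\<bar>" "\<bar>f (-1/2) * sin (\<mu> * (-1/2))\<bar> \<le> \<bar>f (-1/2)\<bar>"
      by (simp_all add: abs_mult mult_left_le)
    moreover have "\<bar>R\<bar> \<le> B"
    proof -
      have "norm R \<le> B * measure lborel {-1/2..1/2::real}"
        unfolding R_def
      proof (rule has_integral_bound_real[OF B0 finite.emptyI])
        show "((\<lambda>x. f' x * sin (\<mu> * x)) has_integral integral {-1/2..1/2} (\<lambda>x. f' x * sin (\<mu> * x))) {-1/2..1/2}"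
          by (intro integrable_integral integrable_continuous_interval continuous_intros cont)
        show "norm (f' x * sin (\<mu> * x)) \<le> B" if "x \<in> {-1/2..1/2} - {}" for x
          using mult_mono[OF B[of x] abs_sin_le_one[of "\<mu> * x"]] B0 that by (simp add: abs_mult)
      qed
      then show ?thesis by simp
    qed
    ultimately have *: "\<bar>\<mu> * oddcos_coeff f j\<bar> \<le> \<bar>f (1/2)\<bar> + \<bar>f (-1/2)\<bar> + B"
      by linarith
    have "\<bar>(real j + 1/2) * oddcos_coeff f j\<bar> \<le> \<bar>\<mu> * oddcos_coeff f j\<bar>"
      unfolding abs_mult
    proof (intro mult_right_mono)
      have "(real j + 1/2) * 1 \<le> real (2 * j + 1) * pi" using pi_gt3 by (intro mult_mono) auto
      then show "\<bar>real j + 1/2\<bar> \<le> \<bar>\<mu>\<bar>" by (simp add: \<mu>_def)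
    qed auto
    with * show "\<bar>(real j + 1/2) * oddcos_coeff f j\<bar> \<le> \<bar>f (1/2)\<bar> + \<bar>f (-1/2)\<bar> + B"
      by linarith
  qed
qed

lemma alternating_le_max_fourier:
  assumes "smooth_on_interval (-1/2) (1/2) f"
  shows "(-1) ^ j * ((real j + 1/2) * oddcos_coeff f j) \<le> max_fourier f"
proof -
  obtain f' where f': "\<And>x. x \<in> {-1/2..1/2} \<Longrightarrow> (f has_real_derivative f' x) (at x within {-1/2..1/2})"
    "continuous_on {-1/2..1/2} f'"
    using smooth_imp_C1[OF assms] by blast
  then have contf: "continuous_on {-1/2..1/2} f"
    by (intro DERIV_continuous_on)
  obtain K where K: "\<And>j. \<bar>(real j + 1/2) * oddcos_coeff f j\<bar> \<le> K"
    using oddcos_coeff_decay[OF f'] by blast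
  define u where "u j = (real j + 1/2) * oddcos_coeff f j" for j
  have Ku: "u j \<le> K" "- K \<le> u j" for j
    using K[of j] by (auto simp: u_def)
  have u_even: "(2 * real k + 1/2) * Re (fourier f (2 * real k + 1/2)) = u (2 * k)" for k
    using Re_fourier_half_odd[OF contf, of "2 * k"] by (simp add: u_def)
  have u_odd: "(2 * real k + 3/2) * Re (fourier f (2 * real k + 3/2)) = u (2 * k + 1)" for k
    using Re_fourier_half_odd[OF contf, of "2 * k + 1"] by (simp add: u_def add_ac)
  have max: "max_fourier f = max (SUP k. u (2 * k)) (- (INF k. u (2 * k + 1)))"
    unfolding max_fourier_def u_even u_odd ..
  show ?thesis
  proof (cases "even j")
    case True
    then obtain k where k: "j = 2 * k" by blast
    have "u (2 * k) \<le> (SUP k. u (2 * k))"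
      by (rule cSUP_upper) (auto intro!: bdd_aboveI[of _ K] Ku)
    then show ?thesis unfolding max u_def[symmetric] k by simp
  next
    case False
    then obtain k where k: "j = 2 * k + 1" by (blast elim: oddE)
    have "(INF k. u (2 * k + 1)) \<le> u (2 * k + 1)"
      by (rule cINF_lower) (auto intro!: bdd_belowI[of _ "- K"] Ku)
    then show ?thesis unfolding max u_def[symmetric] k by simp
  qed
qed

section \<open>The lower bound\<close>

theorem mainTheorem3:
  fixes \<alpha> :: nat and f :: "real \<Rightarrow> real"
  assumes "\<alpha> \<in> {2, 3, 4, 5, 6}"
    and "smooth_on_interval (-1/2) (1/2) f"
    and "\<forall>x\<in>{-1/2..1/2}. f (- x) = f x"
  shows "max_fourier f \<ge>
    (real \<alpha> + 1) / (real \<alpha> * pi) * integral {-1/2..1/2} (\<lambda>x. (1 - \<bar>2 * x\<bar> ^ \<alpha>) * f x)"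
proof -
  define M where "M = max_fourier f"
  define w where "w = (\<lambda>x::real. 1 - \<bar>2 * x\<bar> ^ \<alpha>)"
  \<comment> \<open>\<open>\<pi> M\<close> is the constant for which equality holds in all the bounds by \<open>M\<close>.\<close>
  define g where "g = (\<lambda>x. pi * M - f x)"
  obtain m where m: "\<alpha> = Suc (Suc m)" "m \<le> 4"
    using that[of "\<alpha> - 2"] assms(1) by auto
  have contf: "continuous_on {-1/2..1/2} f"
    using smooth_imp_C1[OF assms(2)] by (metis DERIV_continuous_on)
  have contw: "continuous_on {-1/2..1/2} w"
    unfolding w_def by (intro continuous_intros)
  have contg: "continuous_on {-1/2..1/2} g"
    unfolding g_def by (intro continuous_intros contf)
  have sq: "(-1) ^ j * (-1) ^ j = (1::real)" for j by (simp flip: power_mult_distrib)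
  have g_sign: "0 \<le> (-1) ^ j * oddcos_coeff g j" for j
  proof -
    have "oddcos_coeff g j = pi * M * (2 * (-1) ^ j / (real (2 * j + 1) * pi)) - oddcos_coeff f j"
      unfolding g_def by (simp only: oddcos_coeff_diff[OF continuous_on_const contf] oddcos_coeff_const)
    also have "pi * M * (2 * (-1) ^ j / (real (2 * j + 1) * pi)) = M * (-1) ^ j / (real j + 1/2)"
    proof -
      have "real (2 * j + 1) = 2 * (real j + 1/2)" by simp
      moreover have "pi * M * (2 * s / (2 * \<xi> * pi)) = M * s / \<xi>" for s \<xi> :: real by simp
      ultimately show ?thesis by presburger
    qed
    finally have "(real j + 1/2) * ((-1) ^ j * oddcos_coeff g j)
        = M * ((-1) ^ j * (-1) ^ j) - (-1) ^ j * ((real j + 1/2) * oddcos_coeff f j)"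
      by (simp add: right_diff_distrib mult_ac add_pos_nonneg)
    also have "\<dots> \<ge> 0"
      using alternating_le_max_fourier[OF assms(2), of j] by (simp only: sq M_def)
    finally show ?thesis by (simp add: zero_le_mult_iff)
  qed
  have w_sign: "0 \<le> (-1) ^ j * oddcos_coeff w j" for j
  proof -
    have "(-1) ^ j * oddcos_coeff w j
        = 8 * real (m + 2) * real (m + 1) / (real (2 * j + 1) * pi)\<^sup>2 * ((-1) ^ j * half_moment j m)"
      unfolding w_def m oddcos_coeff_power_weight by simp
    then show ?thesis using half_moment_alternating[OF m(2), of j] by simp
  qed
  have series: "(\<lambda>j. 2 * oddcos_coeff w j * oddcos_coeff g j) sums integral {-1/2..1/2} (\<lambda>x. w x * g x)"
  proof (rule parseval_oddcos[OF contw _ _ contg])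
    show "summable (\<lambda>j. \<bar>oddcos_coeff w j\<bar>)"
      unfolding w_def m by (rule summable_oddcos_coeff_power_weight)
  qed (simp add: w_def)
  have terms: "0 \<le> 2 * oddcos_coeff w j * oddcos_coeff g j" for j
  proof -
    have "2 * oddcos_coeff w j * oddcos_coeff g j
        = 2 * (((-1) ^ j * oddcos_coeff w j) * ((-1) ^ j * oddcos_coeff g j))"
      using sq[of j] by (simp add: algebra_simps)
    also have "0 \<le> \<dots>"
      by (intro mult_nonneg_nonneg w_sign g_sign) simp
    finally show ?thesis .
  qed
  have "0 \<le> integral {-1/2..1/2} (\<lambda>x. w x * g x)"
    by (rule sums_le[OF terms sums_zero series])
  also have "integral {-1/2..1/2} (\<lambda>x. w x * g x)
      = integral {-1/2..1/2} (\<lambda>x. pi * M * w x - w x * f x)"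
    by (simp add: g_def algebra_simps)
  also have "\<dots> = pi * M * integral {-1/2..1/2} w - integral {-1/2..1/2} (\<lambda>x. w x * f x)"
    unfolding Henstock_Kurzweil_Integration.integral_mult_right[symmetric]
    by (intro Henstock_Kurzweil_Integration.integral_diff integrable_continuous_interval
          continuous_intros contw contf)
  also have "integral {-1/2..1/2} w = real \<alpha> / (real \<alpha> + 1)"
    unfolding w_def by (rule integral_power_weight)
  finally have "integral {-1/2..1/2} (\<lambda>x. w x * f x) \<le> pi * M * (real \<alpha> / (real \<alpha> + 1))"
    by simp
  then have "(real \<alpha> + 1) / (real \<alpha> * pi) * integral {-1/2..1/2} (\<lambda>x. w x * f x)
      \<le> (real \<alpha> + 1) / (real \<alpha> * pi) * (pi * M * (real \<alpha> / (real \<alpha> + 1)))"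
    by (intro mult_left_mono) auto
  also have "\<dots> = M"
  proof -
    have "(a + 1) / (a * pi) * (pi * M * (a / (a + 1))) = M" if "a > 0" for a
      using that by (simp add: divide_simps)
    then show ?thesis using m(1) by simp
  qed
  finally show ?thesis by (simp add: M_def w_def)
qed

end
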